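(* Let $X$ be a real Banach space with the Radon-Nikodym property. Let $f \in S_{X^*}$ and $\varepsilon \in (0,1)$. Then there exists a function $t : X \to S_{X^*} \cap B(f,\varepsilon)$ such that for every sequence $(x_n)_{n\in\mathbb{N}}$ in $X$: if the sequence $\bigl(f(x_n) - \varepsilon \|x_n\|\bigr)_n$ is bounded below and if $\langle t(x_n), x_{n+1} - x_n \rangle \leqslant 0$ for all $n \in \mathbb{N}$, then the sequence $(x_n)$ converges in $X$.
   Context: $X^*$ is the dual of $X$, $S_{X^*}=\{g\in X^*:\|g\|=1\}$ its unit sphere, and $B(f,\varepsilon)=\{g\in X^*:\|f-g\|<\varepsilon\}$. For $g\in X^*$ and $x\in X$, $\langle g,x\rangle=g(x)$. Radon-Nikodym property: $X$ has the Radon-Nikodym property if for every non-empty closed convex bounded subset $C$ of $X$ and every $\eta>0$ there exist $g\in S_{X^*}$ and $c\in\mathbb{R}$ such that $\{x\in C: g(x)<c\}$ is non-empty and has diameter less than $\eta$. *)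

theory Defs
  imports "HOL-Analysis.Analysis"
begin

text \<open>
  The real Banach space is the type \<^typ>\<open>'a\<close> of class \<^class>\<open>banach\<close>, and its dual is
  the type \<^typ>\<open>'a \<Rightarrow>\<^sub>L real\<close> of bounded linear functionals with the operator norm.
\<close>

definition radon_nikodym_property :: "'a::banach itself \<Rightarrow> bool" where
  "radon_nikodym_property _ \<longleftrightarrow>
    (\<forall>C :: 'a set. \<forall>\<eta>::real.
      C \<noteq> {} \<longrightarrow> closed C \<longrightarrow> convex C \<longrightarrow> bounded C \<longrightarrow> \<eta> > 0 \<longrightarrow>
      (\<exists>g :: 'a \<Rightarrow>\<^sub>L real. g \<in> sphere 0 1 \<and>
        (\<exists>c::real. {x \<in> C. blinfun_apply g x < c} \<noteq> {} \<and>
          diameter {x \<in> C. blinfun_apply g x < c} < \<eta>)))"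

end

theory Submission
  imports Defs
begin

text \<open>
  A closed convex set can be exhausted transfinitely by removing small slices. If a point in a removed
  slice is assigned the slicing functional, then a move that does not increase this functional cannot
  enter what remains, so the ordinal index of the slice decreases along the sequence and stabilises.
  Each slice is then cut again into smaller slices by functionals so close to the first one that the
  same moves are still controlled, and \<open>t x\<close> is the limit of the functionals assigned to \<open>x\<close>.

  What makes this possible is that functionals with arbitrarily small slices are dense near \<open>f\<close>. This
  follows from the Radon-Nikodym property applied to the set of all minimisers of functionals near a
  given one, by means of the Bishop-Phelps theorem.
\<close>

section \<open>The Hahn-Banach theorem for sublinear functionals\<close>

text \<open>The functional at a point is fixed before the next point is known, and this one
  functional must control the move at every scale. Hence each stage keeps an open set of
  functionals: the choice at one scale may still be perturbed at the next. No estimate on the moves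
  is needed for convergence: at every scale the sequence ends up in one block, and block diameters
  tend to zero. The obstacle in cutting a slice again is that it is not closed, and that a move may
  leave it for the set that remains. The pieces are therefore cut from the closed convex body, with
  a margin that keeps moves away from the remainder, and cutting stops once only the remainder is
  left. The space itself is split into shells between the sets
  \<open>f x \<ge> e * norm x - M\<close> with integer \<open>M\<close>; there the separating
  functionals come from Hahn-Banach instead of an earlier slice.\<close>

definition sublinear :: "('a::real_vector \<Rightarrow> real) \<Rightarrow> bool" where
  "sublinear p \<longleftrightarrow> (\<forall>x y. p (x + y) \<le> p x + p y) \<and> (\<forall>c x. 0 \<le> c \<longrightarrow> p (c *\<^sub>R x) = c * p x)"

lemma sublinear_add: "sublinear p \<Longrightarrow> p (x + y) \<le> p x + p y"
  and sublinear_scaleR: "sublinear p \<Longrightarrow> 0 \<le> c \<Longrightarrow> p (c *\<^sub>R x) = c * p x"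
  by (auto simp: sublinear_def)

lemma sublinear_zero: "sublinear p \<Longrightarrow> p 0 = 0"
  using sublinear_scaleR[of p 0 0] by simp

lemma sublinear_minus: "sublinear p \<Longrightarrow> - p (- x) \<le> p x"
  using sublinear_add[of p x "- x"] by (simp add: sublinear_zero)

lemma sublinearI:
  assumes "\<And>x y. p (x + y) \<le> p x + p y"
    and le: "\<And>c x. 0 < c \<Longrightarrow> p (c *\<^sub>R x) \<le> c * p x" and "p 0 = 0"
  shows "sublinear p"
proof -
  have "p (c *\<^sub>R x) = c * p x" if "0 \<le> c" for c x
  proof (cases "c = 0")
    case False
    with that have c: "0 < c" by simp
    have "p x \<le> inverse c * p (c *\<^sub>R x)"
      using le[of "inverse c" "c *\<^sub>R x"] c by simp
    with c have "c * p x \<le> p (c *\<^sub>R x)" by (simp add: field_simps)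
    with le[OF c, of x] show ?thesis by simp
  qed (use assms(3) in simp)
  with assms(1) show ?thesis by (simp add: sublinear_def)
qed

text \<open>The infimum is finite because \<open>- p (- x) \<le> - q (- x) \<le> q x\<close>. For
  subadditivity, two members of the chain are replaced by the smaller one.\<close>

lemma sublinear_INF_chain:
  assumes C: "C \<noteq> {}" "\<And>q. q \<in> C \<Longrightarrow> sublinear q" "\<And>q x. q \<in> C \<Longrightarrow> q x \<le> p x"
    and chain: "\<And>q r. q \<in> C \<Longrightarrow> r \<in> C \<Longrightarrow> q \<le> r \<or> r \<le> q"
  shows "sublinear (\<lambda>x. INF q\<in>C. q x)" and "\<And>x q. q \<in> C \<Longrightarrow> (INF q\<in>C. q x) \<le> q x"
proof -
  let ?m = "\<lambda>x. INF q\<in>C. q x"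
  have "- p (- x) \<le> q x" if "q \<in> C" for q x
    using sublinear_minus[OF C(2)[OF that], of x] C(3)[OF that, of "- x"] by linarith
  then have bdd: "bdd_below ((\<lambda>q. q x) ` C)" for x by (meson bdd_belowI2)
  show low: "?m x \<le> q x" if "q \<in> C" for q x by (rule cINF_lower[OF bdd that])
  have great: "a \<le> ?m x" if "\<And>q. q \<in> C \<Longrightarrow> a \<le> q x" for a x
    using C(1) that by (intro cINF_greatest) auto
  show "sublinear ?m"
  proof (rule sublinearI)
    fix x y
    have "?m (x + y) \<le> q x + r y" if "q \<in> C" "r \<in> C" for q r
    proof -
      have "\<exists>s\<in>C. s \<le> q \<and> s \<le> r" using chain[OF that] that by auto
      then obtain s where s: "s \<in> C" "s \<le> q" "s \<le> r" by blast
      have "?m (x + y) \<le> s (x + y)" by (rule low[OF s(1)])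
      also have "\<dots> \<le> s x + s y" by (rule sublinear_add[OF C(2)[OF s(1)]])
      also have "\<dots> \<le> q x + r y" using s(2,3) by (intro add_mono) (auto simp: le_fun_def)
      finally show ?thesis .
    qed
    then have "?m (x + y) - r y \<le> ?m x" if "r \<in> C" for r
      using that by (intro great) (auto simp: algebra_simps)
    then have "?m (x + y) - ?m x \<le> ?m y" by (intro great) (auto simp: algebra_simps)
    then show "?m (x + y) \<le> ?m x + ?m y" by simp
  next
    fix c :: real and x assume c: "0 < c"
    have "?m (c *\<^sub>R x) / c \<le> ?m x"
    proof (rule great)
      fix q assume q: "q \<in> C"
      have "?m (c *\<^sub>R x) \<le> c * q x"
        using low[OF q, of "c *\<^sub>R x"] sublinear_scaleR[OF C(2)[OF q], of c x] c by simp
      with c show "?m (c *\<^sub>R x) / c \<le> q x" by (simp add: field_simps)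
    qed
    with c show "?m (c *\<^sub>R x) \<le> c * ?m x" by (simp add: field_simps)
  next
    have "?m 0 = (INF q\<in>C. 0)" using sublinear_zero C(2) by (intro INF_cong) auto
    then show "?m 0 = 0" using C(1) by simp
  qed
qed

text \<open>\<open>r\<close> is \<open>q\<close> with its value at \<open>- y\<close> forced down to
  \<open>- q y\<close>. Minimality gives \<open>r = q\<close>, and \<open>t = 1\<close> in the
  infimum is the missing inequality \<open>q x + q y \<le> q (x + y)\<close>.\<close>

lemma minimal_sublinear_additive:
  assumes q: "sublinear q" and min: "\<And>r. sublinear r \<Longrightarrow> r \<le> q \<Longrightarrow> r = q"
  shows "q (x + y) = q x + q y"
proof -
  define r where "r x = (INF t\<in>{0..}. q (x + t *\<^sub>R y) - t * q y)" for x
  have lb: "- q (- x) \<le> q (x + t *\<^sub>R y) - t * q y" if "0 \<le> t" for x t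
    using sublinear_add[OF q, of "x + t *\<^sub>R y" "- x"] sublinear_scaleR[OF q that, of y] by simp
  have low: "r x \<le> q (x + t *\<^sub>R y) - t * q y" if "0 \<le> t" for x t
    unfolding r_def by (rule cINF_lower) (use lb that in \<open>auto intro!: bdd_belowI2\<close>)
  have great: "a \<le> r x" if "\<And>t. 0 \<le> t \<Longrightarrow> a \<le> q (x + t *\<^sub>R y) - t * q y" for a x
    unfolding r_def using that by (intro cINF_greatest) auto
  have "sublinear r"
  proof (rule sublinearI)
    fix u v
    have "r (u + v) \<le> (q (u + s *\<^sub>R y) - s * q y) + (q (v + t *\<^sub>R y) - t * q y)"
      if "0 \<le> s" "0 \<le> t" for s t
    proof -
      have "r (u + v) \<le> q ((u + s *\<^sub>R y) + (v + t *\<^sub>R y)) - (s + t) * q y"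
        using low[of "s + t" "u + v"] that by (simp add: algebra_simps)
      with sublinear_add[OF q, of "u + s *\<^sub>R y" "v + t *\<^sub>R y"] show ?thesis
        by (simp add: algebra_simps)
    qed
    then have "r (u + v) - (q (v + t *\<^sub>R y) - t * q y) \<le> r u" if "0 \<le> t" for t
      using that by (intro great) (simp add: algebra_simps)
    then have "r (u + v) - r u \<le> r v" by (intro great) (simp add: algebra_simps)
    then show "r (u + v) \<le> r u + r v" by simp
  next
    fix c :: real and u assume c: "0 < c"
    have "r (c *\<^sub>R u) / c \<le> r u"
    proof (rule great)
      fix t :: real assume t: "0 \<le> t"
      have "r (c *\<^sub>R u) \<le> q (c *\<^sub>R (u + t *\<^sub>R y)) - (c * t) * q y"
        using low[of "c * t" "c *\<^sub>R u"] c t by (simp add: algebra_simps)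
      also have "\<dots> = c * (q (u + t *\<^sub>R y) - t * q y)"
        using sublinear_scaleR[OF q, of c "u + t *\<^sub>R y"] c by (simp add: algebra_simps)
      finally show "r (c *\<^sub>R u) / c \<le> q (u + t *\<^sub>R y) - t * q y"
        using c by (simp add: field_simps)
    qed
    with c show "r (c *\<^sub>R u) \<le> c * r u" by (simp add: field_simps)
  next
    have "0 \<le> r 0" by (rule great) (simp add: sublinear_scaleR[OF q])
    moreover have "r 0 \<le> 0" using low[of 0 0] by (simp add: sublinear_zero[OF q])
    ultimately show "r 0 = 0" by simp
  qed
  moreover have "r \<le> q" using low[of 0] by (auto simp: le_fun_def)
  ultimately have "r = q" by (rule min)
  then have "q x \<le> q (x + y) - q y" using low[of 1 x] by simp
  with sublinear_add[OF q, of x y] show ?thesis by simp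
qed

theorem hahn_banach_sublinear:
  fixes p :: "'a::real_vector \<Rightarrow> real"
  assumes p: "sublinear p"
  obtains u where "linear u" "\<And>x. u x \<le> p x"
proof -
  define A where "A = {q. sublinear q \<and> q \<le> p}"
  have "\<exists>m\<in>A. \<forall>a\<in>A. m \<ge> a \<longrightarrow> a = m"
  proof (rule predicate_Zorn)
    show "partial_order_on A (relation_of (\<lambda>a b. b \<le> a) A)"
      by (rule partial_order_on_relation_ofI) auto
    fix C assume "C \<in> Chains (relation_of (\<lambda>a b. b \<le> a) A)"
    then have C: "q \<in> A" "q \<le> r \<or> r \<le> q" if "q \<in> C" "r \<in> C" for q r
      using that by (auto simp: Chains_def relation_of_def)
    show "\<exists>u\<in>A. \<forall>a\<in>C. u \<le> a"
    proof (cases "C = {}")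
      case True
      then show ?thesis using p by (auto simp: A_def)
    next
      case False
      then obtain q where q: "q \<in> C" by blast
      have sl: "sublinear q" "q x \<le> p x" if "q \<in> C" for q x
        using C(1)[OF that that] by (auto simp: A_def le_fun_def)
      have m: "sublinear (\<lambda>x. INF q\<in>C. q x)" "(INF q\<in>C. q x) \<le> q x" if "q \<in> C" for q x
        by (rule sublinear_INF_chain[OF False]; use sl C(2) that in blast)+
      have "(\<lambda>x. INF q\<in>C. q x) \<in> A"
        using m(1)[OF q] order_trans[OF m(2)[OF q] sl(2)[OF q]] by (simp add: A_def le_fun_def)
      with m(2) show ?thesis by (auto simp: le_fun_def intro!: bexI)
    qed
  qed
  then obtain q where q: "sublinear q" "q \<le> p" and min: "\<And>r. sublinear r \<Longrightarrow> r \<le> q \<Longrightarrow> r = q"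
    unfolding A_def using order_trans by blast
  have add: "q (x + y) = q x + q y" for x y by (rule minimal_sublinear_additive[OF q(1) min])
  have neg: "q (- x) = - q x" for x using add[of x "- x"] by (simp add: sublinear_zero[OF q(1)])
  have "q (c *\<^sub>R x) = c * q x" for c x
    using sublinear_scaleR[OF q(1), of c x] sublinear_scaleR[OF q(1), of "- c" x] neg[of "c *\<^sub>R x"]
    by (cases "0 \<le> c") auto
  with add have "linear q" by (intro linearI) auto
  with q(2) that show ?thesis by (auto simp: le_fun_def)
qed

lemma hahn_banach_norm_bounded:
  fixes p :: "'a::real_normed_vector \<Rightarrow> real"
  assumes p: "sublinear p" and r: "\<And>x. p x \<le> r * norm x" "0 \<le> r"
  obtains u :: "'a \<Rightarrow>\<^sub>L real" where "norm u \<le> r" "\<And>x. blinfun_apply u x \<le> p x"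
proof -
  obtain u where u: "linear u" "\<And>x. u x \<le> p x" using hahn_banach_sublinear[OF p] by blast
  have ub: "norm (u x) \<le> r * norm x" for x
    using order_trans[OF u(2) r(1), of x] order_trans[OF u(2) r(1), of "- x"]
    by (simp add: linear_neg[OF u(1)] abs_le_iff)
  then have bl: "bounded_linear u"
    using u(1) by (auto simp: linear_conv_bounded_linear bounded_linear_def bounded_linear_axioms_def linear_def mult.commute)
  show ?thesis
  proof
    show "norm (Blinfun u) \<le> r"
      using ub r(2) by (intro norm_blinfun_bound) (auto simp: bounded_linear_Blinfun_apply[OF bl])
    show "blinfun_apply (Blinfun u) x \<le> p x" for x
      by (simp add: bounded_linear_Blinfun_apply[OF bl] u(2))
  qed
qed

text \<open>Hahn-Banach applied to the infimal convolution
  \<open>x \<mapsto> inf {r * norm (x + w) + \<phi> w | w \<in> W}\<close>.\<close>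

lemma cone_sandwich:
  fixes \<phi> :: "'a::real_normed_vector \<Rightarrow> real"
  assumes zero: "0 \<in> W" and addW: "\<And>v w. v \<in> W \<Longrightarrow> w \<in> W \<Longrightarrow> v + w \<in> W"
    and scaleW: "\<And>c w. 0 < c \<Longrightarrow> w \<in> W \<Longrightarrow> c *\<^sub>R w \<in> W"
    and zero': "\<phi> 0 = 0" and add: "\<And>v w. v \<in> W \<Longrightarrow> w \<in> W \<Longrightarrow> \<phi> (v + w) \<le> \<phi> v + \<phi> w"
    and scale: "\<And>c w. 0 < c \<Longrightarrow> w \<in> W \<Longrightarrow> \<phi> (c *\<^sub>R w) \<le> c * \<phi> w"
    and ge: "\<And>w. w \<in> W \<Longrightarrow> - r * norm w \<le> \<phi> w" and r: "0 \<le> r"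
  obtains u :: "'a \<Rightarrow>\<^sub>L real" where "norm u \<le> r" "\<And>w. w \<in> W \<Longrightarrow> 0 \<le> \<phi> w + blinfun_apply u w"
proof -
  define p where "p x = (INF w\<in>W. r * norm (x + w) + \<phi> w)" for x
  have lb: "- r * norm x \<le> r * norm (x + w) + \<phi> w" if "w \<in> W" for x w
  proof -
    have "r * norm w \<le> r * (norm (x + w) + norm x)"
      using r norm_triangle_ineq4[of "x + w" x] by (intro mult_left_mono) simp_all
    with ge[OF that] show ?thesis by (simp add: algebra_simps)
  qed
  have low: "p x \<le> r * norm (x + w) + \<phi> w" if "w \<in> W" for x w
    unfolding p_def by (rule cINF_lower) (use lb that in \<open>auto intro!: bdd_belowI2\<close>)
  have great: "a \<le> p x" if "\<And>w. w \<in> W \<Longrightarrow> a \<le> r * norm (x + w) + \<phi> w" for a x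
    unfolding p_def using that zero by (intro cINF_greatest) auto
  have "sublinear p"
  proof (rule sublinearI)
    fix x y
    have "p (x + y) \<le> (r * norm (x + v) + \<phi> v) + (r * norm (y + w) + \<phi> w)"
      if "v \<in> W" "w \<in> W" for v w
    proof -
      have "r * norm ((x + v) + (y + w)) \<le> r * (norm (x + v) + norm (y + w))"
        using r norm_triangle_ineq by (intro mult_left_mono)
      with low[OF addW[OF that], of "x + y"] add[OF that] show ?thesis
        by (simp add: algebra_simps)
    qed
    then have "p (x + y) - (r * norm (y + w) + \<phi> w) \<le> p x" if "w \<in> W" for w
      using that by (intro great) (simp add: algebra_simps)
    then have "p (x + y) - p x \<le> p y" by (intro great) (simp add: algebra_simps)
    then show "p (x + y) \<le> p x + p y" by simp
  next
    fix c :: real and x assume c: "0 < c"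
    have "p (c *\<^sub>R x) / c \<le> p x"
    proof (rule great)
      fix w assume w: "w \<in> W"
      have "p (c *\<^sub>R x) \<le> r * norm (c *\<^sub>R (x + w)) + c * \<phi> w"
        using low[OF scaleW[OF c w], of "c *\<^sub>R x"] scale[OF c w] by (simp add: scaleR_right_distrib)
      also have "\<dots> = c * (r * norm (x + w) + \<phi> w)"
        using c by (simp add: distrib_left mult.left_commute)
      finally show "p (c *\<^sub>R x) / c \<le> r * norm (x + w) + \<phi> w" using c by (simp add: field_simps)
    qed
    with c show "p (c *\<^sub>R x) \<le> c * p x" by (simp add: field_simps)
  next
    have "0 \<le> p 0" by (rule great) (use ge in fastforce)
    then show "p 0 = 0" using low[OF zero, of 0] zero' by simp
  qed
  moreover have "p x \<le> r * norm x" for x using low[OF zero, of x] zero' by simp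
  ultimately obtain u :: "'a \<Rightarrow>\<^sub>L real" where u: "norm u \<le> r" "\<And>x. blinfun_apply u x \<le> p x"
    using hahn_banach_norm_bounded r by blast
  \<comment> \<open>At the point \<open>- w\<close> the norm term belonging to \<open>w\<close>
    vanishes, so \<open>u (- w) \<le> p (- w) \<le> \<phi> w\<close>.\<close>
  have "0 \<le> \<phi> w + u w" if "w \<in> W" for w
    using u(2)[of "- w"] low[OF that, of "- w"] by (simp add: blinfun.minus_right)
  with u(1) that show ?thesis by blast
qed

lemma norming_functional:
  fixes x :: "'a::real_normed_vector"
  obtains u :: "'a \<Rightarrow>\<^sub>L real" where "norm u \<le> 1" "blinfun_apply u x = norm x"
proof -
  let ?W = "{t *\<^sub>R x |t. 0 \<le> t}"
  obtain u :: "'a \<Rightarrow>\<^sub>L real" where u: "norm u \<le> 1" "\<And>w. w \<in> ?W \<Longrightarrow> 0 \<le> - norm w + blinfun_apply u w"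
  proof (rule cone_sandwich[of ?W "\<lambda>w. - norm w" 1])
    fix v w assume "v \<in> ?W" "w \<in> ?W"
    then obtain s t where st: "v = s *\<^sub>R x" "w = t *\<^sub>R x" "0 \<le> s" "0 \<le> t" by blast
    then have eq: "v + w = (s + t) *\<^sub>R x" by (simp add: scaleR_left_distrib)
    show "v + w \<in> ?W" unfolding eq using st by fastforce
    show "- norm (v + w) \<le> - norm v + - norm w" unfolding eq using st by (simp add: distrib_right)
  next
    fix c :: real and w assume "0 < c" "w \<in> ?W"
    then obtain t where "c *\<^sub>R w = (c * t) *\<^sub>R x" "0 \<le> c * t" by fastforce
    then show "c *\<^sub>R w \<in> ?W" by blast
  qed (auto intro: exI[of _ 0])
  have "norm x \<le> u x" using u(2)[of "1 *\<^sub>R x"] by fastforce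
  moreover have "u x \<le> norm x"
    using norm_blinfun[of u x] u(1) mult_right_mono[of "norm u" 1 "norm x"] by simp
  ultimately show ?thesis using u(1) that by force
qed

section \<open>Variational principles\<close>

text \<open>The sets \<open>S v\<close> of points reachable from \<open>v\<close> by sufficient descent shrink to a single point along
  a sequence of approximate minimisers; no further descent is possible from that point.\<close>

lemma ekeland:
  fixes \<phi> :: "'a::complete_space \<Rightarrow> real"
  assumes D: "closed D" "y \<in> D" and cont: "continuous_on D \<phi>"
    and bdd: "bdd_below (\<phi> ` D)" and r: "0 < r"
  obtains v where "v \<in> D" "\<phi> v + r * dist y v \<le> \<phi> y" "\<And>z. z \<in> D \<Longrightarrow> \<phi> v \<le> \<phi> z + r * dist v z"
proof -
  define S where "S v = {z \<in> D. \<phi> z + r * dist v z \<le> \<phi> v}" for v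
  have self: "v \<in> S v" if "v \<in> D" for v using that by (simp add: S_def)
  have bddS: "bdd_below (\<phi> ` S v)" for v
    by (rule bdd_below_mono[OF bdd]) (auto simp: S_def)
  have trans: "S w \<subseteq> S v" if "w \<in> S v" for v w
  proof
    fix z assume z: "z \<in> S w"
    have "r * dist v z \<le> r * dist v w + r * dist w z"
      using dist_triangle[of v z w] r by (simp flip: distrib_left)
    then show "z \<in> S v" using z that by (auto simp: S_def)
  qed
  have closedS: "closed (S v)" for v
  proof -
    have "continuous_on D (\<lambda>z. \<phi> z + r * dist v z)" by (intro continuous_intros cont)
    from continuous_closed_preimage[OF this D(1) closed_atMost[of "\<phi> v"]]
    show ?thesis by (simp add: S_def vimage_def Int_def)
  qed
  \<comment> \<open>Take \<open>w\<close> within \<open>(1/2) ^ n\<close> of the infimum over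
    \<open>S v\<close>. As \<open>S w \<subseteq> S v\<close>, no point of \<open>S w\<close> is
    lower by more than that, and the definition of \<open>S w\<close> turns descent into
    distance.\<close>
  have "\<exists>w\<in>S v. \<forall>z\<in>S w. r * dist w z \<le> (1/2) ^ n" if v: "v \<in> D" for v and n :: nat
  proof -
    have "(INF z\<in>S v. \<phi> z) < (INF z\<in>S v. \<phi> z) + (1/2) ^ n" by simp
    then obtain w where w: "w \<in> S v" "\<phi> w < (INF z\<in>S v. \<phi> z) + (1/2) ^ n"
      using cINF_less_iff[OF _ bddS] self[OF v] by blast
    have "r * dist w z \<le> (1/2) ^ n" if "z \<in> S w" for z
    proof -
      have "(INF z\<in>S v. \<phi> z) \<le> \<phi> z" using trans[OF w(1)] that by (intro cINF_lower bddS) auto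
      with w(2) that show ?thesis by (auto simp: S_def)
    qed
    with w(1) show ?thesis by blast
  qed
  then obtain F where F: "\<And>v n. v \<in> D \<Longrightarrow> F v n \<in> S v"
    "\<And>v n z. v \<in> D \<Longrightarrow> z \<in> S (F v n) \<Longrightarrow> r * dist (F v n) z \<le> (1/2) ^ n"
    by metis
  define s where "s = rec_nat y (\<lambda>n v. F v n)"
  have s0: "s 0 = y" and sS: "s (Suc n) = F (s n) n" for n by (simp_all add: s_def)
  have sD: "s n \<in> D" for n
    by (induction n) (use D(2) F(1) in \<open>auto simp: s0 sS S_def\<close>)
  have sub: "S (s (Suc n)) \<subseteq> S (s n)" for n using F(1)[OF sD] by (simp add: sS trans)
  obtain v where v: "\<And>n. v \<in> S (s n)"
  proof (rule decreasing_closed_nest[of "\<lambda>n. S (s n)"])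
    show "S (s n) \<subseteq> S (s m)" if "m \<le> n" for m n
      using lift_Suc_antimono_le[of "\<lambda>n. S (s n)"] sub that by blast
    fix e :: real assume e: "e > 0"
    then obtain n where "(1/2::real) ^ n < r * e / 2"
      using real_arch_pow_inv[of "r * e / 2" "1/2"] r by auto
    then have "r * dist (s (Suc n)) z < r * (e / 2)" if "z \<in> S (s (Suc n))" for z
      using F(2)[OF sD[of n], of z n] that by (simp add: sS)
    then have near: "dist (s (Suc n)) z < e / 2" if "z \<in> S (s (Suc n))" for z
      using r that by simp
    then have "dist x z < e" if "x \<in> S (s (Suc n))" "z \<in> S (s (Suc n))" for x z
      using that dist_triangle_half_r by blast
    then show "\<exists>n. \<forall>x\<in>S (s n). \<forall>y\<in>S (s n). dist x y < e" by blast
  qed (use closedS self[OF sD] in auto)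
  have single: "z = v" if z: "z \<in> S v" for z
  proof (rule ccontr)
    assume "z \<noteq> v"
    then have "0 < r * dist z v / 2" using r by simp
    then obtain n where n: "(1/2::real) ^ n < r * dist z v / 2"
      using real_arch_pow_inv[of "r * dist z v / 2" "1/2"] by auto
    have "z \<in> S (s (Suc n))" "v \<in> S (s (Suc n))" using z v trans by blast+
    then have "r * dist (s (Suc n)) z \<le> (1/2) ^ n" "r * dist (s (Suc n)) v \<le> (1/2) ^ n"
      using F(2)[OF sD] by (auto simp: sS)
    moreover have "r * dist z v \<le> r * dist (s (Suc n)) z + r * dist (s (Suc n)) v"
      using dist_triangle3[of z v "s (Suc n)"] r by (simp flip: distrib_left)
    ultimately show False using n by linarith
  qed
  have "\<phi> v \<le> \<phi> z + r * dist v z" if "z \<in> D" for z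
  proof (cases "z \<in> S v")
    case True
    then have "z = v" by (rule single)
    then show ?thesis by simp
  qed (use that in \<open>auto simp: S_def\<close>)
  with v[of 0] that show ?thesis by (auto simp: s0 S_def)
qed

text \<open>The error \<open>r * s\<close> is traded for a displacement \<open>s\<close> of the
  point and a change \<open>r\<close> of the functional. Ekeland's point minimises
  \<open>\<phi>\<close> plus \<open>r\<close> times the distance to it; the sandwich on the cone
  generated by \<open>D - v\<close> replaces the distance by a functional of norm at most
  \<open>r\<close>.\<close>

theorem bishop_phelps_minimiser:
  fixes \<phi> :: "'a::banach \<Rightarrow>\<^sub>L real"
  assumes D: "closed D" "convex D" "y \<in> D" and min: "\<And>z. z \<in> D \<Longrightarrow> \<phi> y \<le> \<phi> z + r * s"
    and r: "0 < r"
  obtains v \<phi>' where "v \<in> D" "dist y v \<le> s" "norm (\<phi>' - \<phi>) \<le> r"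
    "\<And>z. z \<in> D \<Longrightarrow> blinfun_apply \<phi>' v \<le> \<phi>' z"
proof -
  have "bdd_below (blinfun_apply \<phi> ` D)"
    by (rule bdd_belowI2[of _ "\<phi> y - r * s"]) (use min in \<open>simp add: algebra_simps\<close>)
  moreover have "continuous_on D (blinfun_apply \<phi>)"
    by (rule linear_continuous_on[OF blinfun.bounded_linear_right])
  ultimately obtain v where v: "v \<in> D" "\<phi> v + r * dist y v \<le> \<phi> y"
      "\<And>z. z \<in> D \<Longrightarrow> \<phi> v \<le> \<phi> z + r * dist v z"
    using ekeland[OF D(1,3) _ _ r] by metis
  have "r * dist y v \<le> r * s" using min[OF v(1)] v(2) by simp
  then have dist: "dist y v \<le> s" using r by simp
  let ?W = "{c *\<^sub>R (z - v) |c z. 0 \<le> c \<and> z \<in> D}"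
  obtain u where u: "norm u \<le> r" "\<And>w. w \<in> ?W \<Longrightarrow> 0 \<le> \<phi> w + blinfun_apply u w"
  proof (rule cone_sandwich[of ?W "blinfun_apply \<phi>" r])
    show "0 \<in> ?W" using v(1) by fastforce
    fix a b assume "a \<in> ?W" "b \<in> ?W"
    then obtain c z c' z' where ab: "a = c *\<^sub>R (z - v)" "b = c' *\<^sub>R (z' - v)"
      "0 \<le> c" "0 \<le> c'" "z \<in> D" "z' \<in> D" by blast
    show "a + b \<in> ?W"
    proof (cases "c + c' = 0")
      case True
      then have "c = 0" "c' = 0" using ab by auto
      then show ?thesis using ab by force
    next
      case False
      have "(c / (c + c')) *\<^sub>R z + (c' / (c + c')) *\<^sub>R z' \<in> D" (is "?z \<in> D")
        using ab False by (intro convexD[OF D(2)]) (auto simp: add_divide_distrib[symmetric])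
      moreover have "(c + c') *\<^sub>R ?z = c *\<^sub>R z + c' *\<^sub>R z'"
        using False by (simp add: scaleR_right_distrib)
      then have "a + b = (c + c') *\<^sub>R (?z - v)"
        using ab by (simp add: scaleR_right_diff_distrib scaleR_left_distrib)
      ultimately show ?thesis using ab by fastforce
    qed
  next
    fix c :: real and w assume "0 < c" "w \<in> ?W"
    then obtain a z where "c *\<^sub>R w = (c * a) *\<^sub>R (z - v)" "0 \<le> c * a" "z \<in> D" by fastforce
    then show "c *\<^sub>R w \<in> ?W" by blast
  next
    fix w assume "w \<in> ?W"
    then obtain a z where w: "w = a *\<^sub>R (z - v)" "0 \<le> a" "z \<in> D" by blast
    have "a * (- r * dist v z) \<le> a * (\<phi> z - \<phi> v)"
      using v(3)[OF w(3)] w(2) by (intro mult_left_mono) auto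
    then show "- r * norm w \<le> \<phi> w"
      using w by (simp add: blinfun.scaleR_right blinfun.diff_right dist_norm norm_minus_commute mult.left_commute)
  qed (use r in \<open>auto simp: blinfun.add_right blinfun.scaleR_right\<close>)
  have "(\<phi> + u) v \<le> (\<phi> + u) z" if "z \<in> D" for z
  proof -
    have "z - v \<in> ?W" using that by (force intro!: exI[of _ 1])
    from u(2)[OF this] show ?thesis by (simp add: blinfun.add_left blinfun.diff_right)
  qed
  with that[of v "\<phi> + u"] v(1) dist u(1) show ?thesis by simp
qed

section \<open>Density of small slices\<close>

text \<open>For \<open>M = 0\<close> this is a Bishop-Phelps cone. A lower bound on
  \<open>f - e * norm\<close> along a sequence means that it stays in one of these sets.\<close>

definition cone_set :: "('a::real_normed_vector \<Rightarrow>\<^sub>L real) \<Rightarrow> real \<Rightarrow> real \<Rightarrow> 'a set" where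
  "cone_set f e M = {x. e * norm x - M \<le> blinfun_apply f x}"

lemma closed_cone_set: "closed (cone_set f e M)"
  unfolding cone_set_def by (intro closed_Collect_le continuous_intros)

lemma convex_cone_set:
  assumes "0 \<le> e"
  shows "convex (cone_set f e M)"
proof (rule convexI)
  fix x y and u v :: real
  assume xy: "x \<in> cone_set f e M" "y \<in> cone_set f e M" and uv: "0 \<le> u" "0 \<le> v" "u + v = 1"
  have "e * norm (u *\<^sub>R x + v *\<^sub>R y) \<le> e * (u * norm x + v * norm y)"
    using norm_triangle_ineq[of "u *\<^sub>R x" "v *\<^sub>R y"] uv assms by (intro mult_left_mono) auto
  also have "\<dots> = u * (e * norm x - M) + v * (e * norm y - M) + (u + v) * M"
    by (simp add: algebra_simps)
  also have "\<dots> \<le> u * f x + v * f y + (u + v) * M"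
    using xy uv by (intro add_mono mult_left_mono) (auto simp: cone_set_def)
  finally show "u *\<^sub>R x + v *\<^sub>R y \<in> cone_set f e M"
    using uv by (simp add: cone_set_def blinfun.add_right blinfun.scaleR_right)
qed

lemma blinfun_diff_le: "\<bar>blinfun_apply g x - blinfun_apply f x\<bar> \<le> norm (g - f) * norm x"
  using norm_blinfun[of "g - f" x] by (simp add: blinfun.diff_left)

text \<open>Replacing \<open>f\<close> by \<open>g\<close> costs at most \<open>e - k\<close> of the
  growth rate \<open>e\<close>. With \<open>k > 0\<close> it follows that \<open>g\<close> has
  bounded sublevel sets in the cone set.\<close>

lemma cone_set_coercive:
  assumes "x \<in> cone_set f e M" and "norm (g - f) \<le> e - k"
  shows "k * norm x - M \<le> blinfun_apply g x"
proof -
  have "norm (g - f) * norm x \<le> (e - k) * norm x" using assms(2) by (intro mult_right_mono) auto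
  with blinfun_diff_le[of g x f] assms(1) show ?thesis by (simp add: cone_set_def algebra_simps)
qed

lemma closed_half_space_blinfun:
  fixes g :: "'a::real_normed_vector \<Rightarrow>\<^sub>L real"
  shows "closed {x. a \<le> blinfun_apply g x}"
  by (intro closed_Collect_le continuous_intros)

lemma convex_half_space_blinfun:
  fixes g :: "'a::real_normed_vector \<Rightarrow>\<^sub>L real"
  shows "convex {x. a \<le> blinfun_apply g x}"
  using convex_linear_vimage[of "blinfun_apply g" "{a..}"]
  by (simp add: vimage_def blinfun.bounded_linear_right bounded_linear.linear)

text \<open>The property concerns closed convex sets, so it is applied to the closed convex hull of
  \<open>A\<close>. The slice meets \<open>A\<close> itself, since otherwise a closed half space
  would contain \<open>A\<close> and hence the hull.\<close>

lemma radon_nikodym_slice: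
  fixes A :: "'a::banach set"
  assumes "radon_nikodym_property TYPE('a)"
    and "A \<noteq> {}" "bounded A" "0 < \<eta>"
  obtains h :: "'a \<Rightarrow>\<^sub>L real" and c where "norm h = 1" "\<exists>x\<in>A. h x < c"
    "\<And>x y. x \<in> A \<Longrightarrow> y \<in> A \<Longrightarrow> h x < c \<Longrightarrow> h y < c \<Longrightarrow> dist x y < \<eta>"
proof -
  define C where "C = closure (convex hull A)"
  have AC: "A \<subseteq> C" unfolding C_def by (rule order_trans[OF hull_subset closure_subset])
  have C: "C \<noteq> {}" "closed C" "convex C" "bounded C"
    using assms(2,3) by (simp_all add: C_def bounded_convex_hull bounded_closure convex_closure)
  obtain h :: "'a \<Rightarrow>\<^sub>L real" and c where h: "norm h = 1" "{x \<in> C. h x < c} \<noteq> {}"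
      "diameter {x \<in> C. h x < c} < \<eta>"
    using assms(1)[unfolded radon_nikodym_property_def, rule_format, OF C assms(4)]
    by (auto simp del: Collect_empty_eq)
  have "\<exists>x\<in>A. h x < c"
  proof (rule ccontr)
    assume "\<not> (\<exists>x\<in>A. h x < c)"
    then have "A \<subseteq> {x. c \<le> h x}" by auto
    then have "C \<subseteq> {x. c \<le> h x}"
      unfolding C_def by (intro closure_minimal hull_minimal closed_half_space_blinfun convex_half_space_blinfun)
    with h(2) show False by auto
  qed
  moreover have "bounded {x \<in> C. h x < c}" by (rule bounded_subset[OF C(4)]) auto
  then have "dist x y < \<eta>" if "x \<in> A" "y \<in> A" "h x < c" "h y < c" for x y
    using diameter_bounded_bound[of "{x \<in> C. h x < c}" x y] h(3) that AC by fastforce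
  ultimately show ?thesis using that h(1) by blast
qed

text \<open>Applying the Radon-Nikodym property to the set \<open>A\<close> of all minimisers of functionals close to
  \<open>g\<close> gives a slicing functional \<open>h\<close> with no relation to \<open>g\<close>. But if \<open>\<phi>\<close> attains its minimum at a
  point of that slice, every approximate minimiser \<open>y\<close> of \<open>\<phi> + s h\<close> has a smaller \<open>h\<close>-value up to
  an error, and is close to \<open>A\<close> by Bishop-Phelps; hence \<open>\<phi> + s h\<close> has small slices too.\<close>

lemma small_slice_dense:
  fixes f g :: "'a::banach \<Rightarrow>\<^sub>L real"
  assumes rnp: "radon_nikodym_property TYPE('a)"
    and D: "closed D" "convex D" "D \<noteq> {}" "D \<subseteq> cone_set f e M"
    and g: "norm (g - f) < e" and pos: "0 < \<delta>" "0 < \<eta>"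
  obtains h :: "'a \<Rightarrow>\<^sub>L real" and c where "norm (h - g) < \<delta>" "\<exists>x\<in>D. h x < c"
    "\<And>x y. x \<in> D \<Longrightarrow> y \<in> D \<Longrightarrow> h x < c \<Longrightarrow> h y < c \<Longrightarrow> dist x y < \<eta>"
proof -
  \<comment> \<open>Half of the gap is available for perturbing \<open>g\<close>, the other half
    remains as the coercivity constant.\<close>
  define k where "k = (e - norm (g - f)) / 2"
  define d where "d = min \<delta> k"
  have k: "0 < k" using g by (simp add: k_def)
  with pos have d: "0 < d" "d \<le> \<delta>" "d \<le> k" by (simp_all add: d_def)
  have coer: "k * norm x - M \<le> \<phi> x" if "norm (\<phi> - g) < d" "x \<in> D" for \<phi> x
  proof (rule cone_set_coercive)
    have "norm (\<phi> - f) \<le> norm (\<phi> - g) + norm (g - f)"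
      using norm_triangle_ineq[of "\<phi> - g" "g - f"] by simp
    with that d(3) show "norm (\<phi> - f) \<le> e - k" unfolding k_def by (simp add: field_simps)
  qed (use that D in auto)
  have near_min: "\<exists>y\<in>D. \<forall>z\<in>D. \<phi> y \<le> \<phi> z + b"
    if "norm (\<phi> - g) < d" "0 < b" for \<phi> :: "'a \<Rightarrow>\<^sub>L real" and b
  proof -
    have "- M \<le> \<phi> x" if "x \<in> D" for x
      using coer[OF \<open>norm (\<phi> - g) < d\<close> that] k
      by (smt (verit) mult_nonneg_nonneg norm_ge_zero)
    then have bdd: "bdd_below (blinfun_apply \<phi> ` D)" by (meson bdd_belowI2)
    have "(INF z\<in>D. \<phi> z) < (INF z\<in>D. \<phi> z) + b" using that by simp
    then obtain y where "y \<in> D" "\<phi> y < (INF z\<in>D. \<phi> z) + b"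
      using cINF_less_iff[OF D(3) bdd] by blast
    with cINF_lower[OF bdd] show ?thesis by (smt (verit))
  qed
  define A where "A = {v \<in> D. \<exists>\<phi>::'a \<Rightarrow>\<^sub>L real. norm (\<phi> - g) < d \<and> (\<forall>z\<in>D. \<phi> v \<le> \<phi> z)}"
  have near_A: "\<exists>v\<in>A. dist y v \<le> s"
    if y: "norm (\<phi> - g) + r < d" "0 < r" "y \<in> D" "\<forall>z\<in>D. \<phi> y \<le> \<phi> z + r * s"
    for \<phi> :: "'a \<Rightarrow>\<^sub>L real" and y r s
  proof -
    obtain v and \<phi>' :: "'a \<Rightarrow>\<^sub>L real" where v: "v \<in> D" "dist y v \<le> s" "norm (\<phi>' - \<phi>) \<le> r"
      "\<And>z. z \<in> D \<Longrightarrow> \<phi>' v \<le> \<phi>' z"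
      using bishop_phelps_minimiser[OF D(1,2) y(3) _ y(2)] y(4) by blast
    have "norm (\<phi>' - g) < d" using norm_triangle_ineq[of "\<phi>' - \<phi>" "\<phi> - g"] v(3) y(1) by simp
    with v show ?thesis unfolding A_def by blast
  qed
  have "A \<noteq> {}"
  proof -
    obtain y where "y \<in> D" "\<forall>z\<in>D. g y \<le> g z + d/2 * 1"
      using near_min[of g "d/2"] d by auto
    with near_A[of g "d/2" y 1] d show ?thesis by auto
  qed
  have "bounded A"
  proof -
    obtain x0 where x0: "x0 \<in> D" using D(3) by blast
    have "norm v \<le> ((norm g + d) * norm x0 + M) / k" if v: "v \<in> A" for v
    proof -
      obtain \<phi> :: "'a \<Rightarrow>\<^sub>L real" where v: "v \<in> D" and \<phi>: "norm (\<phi> - g) < d" "\<phi> v \<le> \<phi> x0"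
        using v x0 unfolding A_def by blast
      have "k * norm v - M \<le> \<phi> x0" using coer[OF \<phi>(1) v] \<phi>(2) by simp
      also have "\<dots> \<le> norm \<phi> * norm x0" using norm_blinfun[of \<phi> x0] by simp
      also have "\<dots> \<le> (norm g + d) * norm x0"
        using \<phi>(1) norm_triangle_sub[of \<phi> g] by (intro mult_right_mono) auto
      finally show ?thesis using k by (simp add: field_simps)
    qed
    then show ?thesis unfolding bounded_iff by blast
  qed
  obtain h :: "'a \<Rightarrow>\<^sub>L real" and c where h: "norm h = 1" "\<exists>x\<in>A. h x < c"
    "\<And>x y. x \<in> A \<Longrightarrow> y \<in> A \<Longrightarrow> h x < c \<Longrightarrow> h y < c \<Longrightarrow> dist x y < \<eta> / 2"
    using radon_nikodym_slice[OF rnp \<open>A \<noteq> {}\<close> \<open>bounded A\<close>, of "\<eta> / 2"] pos by auto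
  then obtain x and \<phi> :: "'a \<Rightarrow>\<^sub>L real" where x: "x \<in> D" "h x < c"
    and \<phi>: "norm (\<phi> - g) < d" "\<And>z. z \<in> D \<Longrightarrow> \<phi> x \<le> \<phi> z"
    unfolding A_def by blast
  \<comment> \<open>Adding \<open>s *\<^sub>R h\<close> leaves room \<open>s / 2\<close> for
    Bishop-Phelps. Below, \<open>\<eta> / 8\<close> bounds the distance to \<open>A\<close>,
    \<open>(c - h x) / 4\<close> keeps the nearby point of \<open>A\<close> in the slice of
    \<open>h\<close>, and the two bounds in \<open>b\<close> serve the comparison with
    \<open>x\<close> and Bishop-Phelps.\<close>
  define s where "s = (d - norm (\<phi> - g)) / 2"
  define \<psi> where "\<psi> = \<phi> + s *\<^sub>R h"
  define l where "l = min (\<eta> / 8) ((c - h x) / 4)"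
  define b where "b = min (s * l) (s / 2 * l)"
  have s: "0 < s" and l: "0 < l" using \<phi>(1) x(2) pos by (auto simp: s_def l_def)
  have b: "0 < b" "b \<le> s * l" "b \<le> s / 2 * l" using s l by (auto simp: b_def)
  have "norm (\<psi> - g) \<le> norm (\<phi> - g) + s"
    using norm_triangle_ineq[of "\<phi> - g" "s *\<^sub>R h"] h(1) s by (simp add: \<psi>_def algebra_simps)
  moreover have "norm (\<phi> - g) + 2 * s = d" by (simp add: s_def field_simps)
  ultimately have \<psi>: "norm (\<psi> - g) < d" "norm (\<psi> - g) + s / 2 < d" using s by linarith+
  obtain y0 where y0: "y0 \<in> D" "\<And>z. z \<in> D \<Longrightarrow> \<psi> y0 \<le> \<psi> z + b / 2"
    using near_min[OF \<psi>(1), of "b / 2"] b(1) by auto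
  define c' where "c' = \<psi> y0 + b / 2"
  have slice: "\<exists>v\<in>A. dist y v \<le> l \<and> h v < c" if y: "y \<in> D" "\<psi> y < c'" for y
  proof -
    have amin: "\<psi> y \<le> \<psi> z + b" if "z \<in> D" for z using y(2) y0(2)[OF that] by (simp add: c'_def)
    then obtain v where v: "v \<in> A" "dist y v \<le> l"
      using near_A[OF \<psi>(2) _ y(1), of l] s b(3) by fastforce
    have "s * h y \<le> s * (h x + l)"
      using amin[OF x(1)] \<phi>(2)[OF y(1)] b(2)
      by (simp add: \<psi>_def blinfun.add_left blinfun.scaleR_left algebra_simps)
    then have "h y \<le> h x + l" using s by simp
    moreover have "h v \<le> h y + l"
      using norm_blinfun[of h "v - y"] h(1) v(2)
      by (simp add: blinfun.diff_right dist_norm norm_minus_commute)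
    moreover have "l \<le> (c - h x) / 4" unfolding l_def by (rule min.cobounded2)
    ultimately have "h v < c" using x(2) by (simp add: field_simps)
    with v show ?thesis by blast
  qed
  show ?thesis
  proof
    show "norm (\<psi> - g) < \<delta>" using \<psi>(1) d by simp
    show "\<exists>x\<in>D. \<psi> x < c'" using y0(1) b(1) by (intro bexI[of _ y0]) (simp_all add: c'_def)
    fix y z assume yz: "y \<in> D" "z \<in> D" "\<psi> y < c'" "\<psi> z < c'"
    then obtain v w where "v \<in> A" "dist y v \<le> l" "h v < c" "w \<in> A" "dist z w \<le> l" "h w < c"
      using slice by meson
    moreover from this have "dist v w < \<eta> / 2" using h(3) by blast
    moreover have "l \<le> \<eta> / 8" by (simp add: l_def)
    ultimately show "dist y z < \<eta>"
      using dist_triangle[of y z v] dist_triangle[of v z w] dist_commute[of w z] pos by linarith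
  qed
qed

text \<open>The radius \<open>\<rho>\<close> leaves room for later perturbations of \<open>h\<close>: a move from the slice that does not
  increase some \<open>\<phi>\<close> in the ball around \<open>h\<close> cannot reach the half space \<open>g \<ge> c\<close>.\<close>

lemma small_slice_room:
  fixes f g :: "'a::banach \<Rightarrow>\<^sub>L real"
  assumes rnp: "radon_nikodym_property TYPE('a)"
    and D: "closed D" "convex D" "D \<subseteq> cone_set f e M"
    and U: "open U" "U \<subseteq> ball f e" "g \<in> U" and x0: "x0 \<in> D" "g x0 < c" and pos: "0 < \<eta>"
  obtains h :: "'a \<Rightarrow>\<^sub>L real" and c' \<rho> where "0 < \<rho>" "\<rho> \<le> \<eta>" "cball h \<rho> \<subseteq> U" "\<exists>x\<in>D. h x < c'"
    "\<And>x y. x \<in> D \<Longrightarrow> y \<in> D \<Longrightarrow> h x < c' \<Longrightarrow> h y < c' \<Longrightarrow> dist x y < \<eta>"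
    "\<And>\<phi> x y. \<phi> \<in> cball h \<rho> \<Longrightarrow> x \<in> D \<Longrightarrow> h x < c' \<Longrightarrow> y \<in> cone_set f e M \<Longrightarrow>
      blinfun_apply \<phi> y \<le> \<phi> x \<Longrightarrow> g y < c"
proof -
  have gf: "norm (g - f) < e" using U by (auto simp: dist_norm norm_minus_commute)
  obtain u where u: "0 < u" "ball g u \<subseteq> U" using U openE by blast
  define k where "k = (e - norm (g - f)) / 2"
  define \<theta> where "\<theta> = c - g x0"
  \<comment> \<open>\<open>R\<close> bounds all points that occur, so that exchanging functionals at
    distance \<open>\<delta>\<close> costs at most \<open>\<delta> * R \<le> \<theta> / 8\<close>.
    The term \<open>norm x0\<close> is a crude estimate of \<open>h x0 - g x0\<close>, used because
    \<open>R\<close> is fixed before \<open>\<delta>\<close>.\<close>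
  define R where "R = max (norm x0) ((g x0 + norm x0 + \<theta> + M) / k) + 1"
  have k: "0 < k" and \<theta>: "0 < \<theta>" using gf x0 by (auto simp: k_def \<theta>_def)
  have R: "1 \<le> R" "norm x0 \<le> R" "(g x0 + norm x0 + \<theta> + M) / k \<le> R" by (auto simp: R_def le_max_iff_disj)
  define \<delta> where "\<delta> = Min {u / 2, k / 2, 1, \<theta> / (8 * R)}"
  have \<delta>: "0 < \<delta>" "\<delta> \<le> u / 2" "\<delta> \<le> k / 2" "\<delta> \<le> 1" "\<delta> \<le> \<theta> / (8 * R)"
    using u k \<theta> R by (auto simp: \<delta>_def)
  have \<delta>R: "\<delta> * R \<le> \<theta> / 8" using \<delta>(5) R(1) by (simp add: field_simps)
  obtain h :: "'a \<Rightarrow>\<^sub>L real" and c1 where h: "norm (h - g) < \<delta>" "\<exists>x\<in>D. h x < c1"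
    "\<And>x y. x \<in> D \<Longrightarrow> y \<in> D \<Longrightarrow> h x < c1 \<Longrightarrow> h y < c1 \<Longrightarrow> dist x y < \<eta>"
    using small_slice_dense[OF rnp D(1,2) _ D(3) gf \<delta>(1) pos] x0 by blast
  \<comment> \<open>The cap makes the slice low for \<open>g\<close> as well; if it is the smaller
    value, \<open>x0\<close> lies in the slice.\<close>
  define c' where "c' = min c1 (h x0 + \<theta> / 4)"
  define \<rho> where "\<rho> = min \<delta> \<eta> / 2"
  have \<rho>: "0 < \<rho>" "\<rho> \<le> \<eta>" "\<rho> < \<delta>" using \<delta>(1) pos by (auto simp: \<rho>_def)
  have near: "norm (\<phi> - g) < 2 * \<delta>" if "\<phi> \<in> cball h \<rho>" for \<phi>
    using norm_triangle_ineq[of "\<phi> - h" "h - g"] that h(1) \<rho>(3)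
    by (simp add: dist_norm norm_minus_commute)
  have coer: "k * norm x - M \<le> \<phi> x" if "x \<in> cone_set f e M" "norm (\<phi> - g) < 2 * \<delta>" for \<phi> x
  proof (rule cone_set_coercive[OF that(1)])
    have "norm (\<phi> - f) \<le> norm (\<phi> - g) + norm (g - f)"
      using norm_triangle_ineq[of "\<phi> - g" "g - f"] by simp
    with that \<delta>(3) show "norm (\<phi> - f) \<le> e - k" unfolding k_def by (simp add: field_simps)
  qed
  have hx0: "h x0 \<le> g x0 + \<theta> / 8" "h x0 \<le> g x0 + norm x0"
  proof -
    have "norm (h - g) * norm x0 \<le> \<delta> * R" "norm (h - g) * norm x0 \<le> 1 * norm x0"
      using h(1) R \<delta>(1,4) by (intro mult_mono; simp)+
    with blinfun_diff_le[of h x0 g] \<delta>R show "h x0 \<le> g x0 + \<theta> / 8" "h x0 \<le> g x0 + norm x0"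
      by auto
  qed
  have bound: "norm x \<le> R"
    if "x \<in> cone_set f e M" "norm (\<phi> - g) < 2 * \<delta>" "\<phi> x \<le> h x0 + \<theta>" for \<phi> x
  proof -
    have "norm x \<le> (g x0 + norm x0 + \<theta> + M) / k"
      using coer[OF that(1,2)] that(3) hx0(2) k by (simp add: field_simps)
    with R(3) show ?thesis by simp
  qed
  show ?thesis
  proof
    show "0 < \<rho>" "\<rho> \<le> \<eta>" by (fact \<rho>)+
    show "cball h \<rho> \<subseteq> U"
      using near u(2) \<delta>(2) by (fastforce simp: dist_norm norm_minus_commute)
    show "\<exists>x\<in>D. h x < c'"
    proof (cases "c1 \<le> h x0 + \<theta> / 4")
      case True
      then show ?thesis using h(2) by (auto simp: c'_def)
    next
      case False
      then show ?thesis using x0(1) \<theta> by (intro bexI[of _ x0]) (auto simp: c'_def)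
    qed
    show "dist x y < \<eta>" if "x \<in> D" "y \<in> D" "h x < c'" "h y < c'" for x y
      using h(3) that by (simp add: c'_def)
    fix \<phi> x y assume \<phi>: "\<phi> \<in> cball h \<rho>" and x: "x \<in> D" "h x < c'"
      and y: "y \<in> cone_set f e M" "blinfun_apply \<phi> y \<le> \<phi> x"
    have hx: "h x \<le> h x0 + \<theta> / 4" using x(2) by (simp add: c'_def)
    then have xR: "norm x \<le> R" using x(1) D(3) h(1) \<delta>(1) \<theta> by (intro bound[of x h]) auto
    have "norm (\<phi> - h) * norm x \<le> \<delta> * R"
      using \<phi> \<rho> \<delta>(1) xR by (intro mult_mono) (auto simp: dist_norm norm_minus_commute)
    then have \<phi>x: "\<phi> x \<le> h x + \<theta> / 8" using blinfun_diff_le[of \<phi> x h] \<delta>R by linarith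
    then have yR: "norm y \<le> R" using y hx near[OF \<phi>] \<theta> by (intro bound[of y \<phi>]) auto
    have "norm (g - \<phi>) * norm y \<le> (2 * \<delta>) * R"
      using near[OF \<phi>] \<delta>(1) yR by (intro mult_mono) (auto simp: norm_minus_commute)
    then have "g y \<le> \<phi> y + \<theta> / 4" using blinfun_diff_le[of g y \<phi>] \<delta>R by linarith
    then have "g y \<le> g x0 + 3 * \<theta> / 4" using y(2) \<phi>x hx hx0(1) by linarith
    also have "\<dots> < g x0 + \<theta>" using \<theta> by simp
    finally show "g y < c" by (simp add: \<theta>_def)
  qed
qed

section \<open>Transfinite iteration by towers\<close>

text \<open>For decreasing \<open>s\<close> these are the transfinite iterates of \<open>s\<close> at \<open>A\<close>, without ordinals.\<close>

inductive_set tower :: "('a set \<Rightarrow> 'a set) \<Rightarrow> 'a set \<Rightarrow> 'a set set"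
  for s :: "'a set \<Rightarrow> 'a set" and A :: "'a set" where
  base: "A \<in> tower s A"
| step: "D \<in> tower s A \<Longrightarrow> s D \<in> tower s A"
| Inter: "\<D> \<noteq> {} \<Longrightarrow> (\<And>D. D \<in> \<D> \<Longrightarrow> D \<in> tower s A) \<Longrightarrow> \<Inter>\<D> \<in> tower s A"

lemma tower_subset:
  assumes "\<And>D. s D \<subseteq> D" and "D \<in> tower s A"
  shows "D \<subseteq> A"
  using assms(2)
proof induction
  case (step D)
  then show ?case using assms(1)[of D] by blast
qed blast+

text \<open>The second hypothesis says that no step of the tower jumps past \<open>C\<close>, so
  each member is still above \<open>C\<close> or already below \<open>s C\<close>.\<close>

lemma tower_comparable_aux:
  assumes dec: "\<And>D. s D \<subseteq> D"
    and C: "\<And>D. D \<in> tower s A \<Longrightarrow> C \<subset> D \<Longrightarrow> C \<subseteq> s D"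
    and "D \<in> tower s A" "C \<in> tower s A"
  shows "D \<subseteq> s C \<or> C \<subseteq> D"
  using assms(3)
proof induction
  case base
  then show ?case using tower_subset[of s, OF dec assms(4)] by blast
next
  case (step D)
  then show ?case using dec[of D] C[of D] by blast
next
  case (Inter \<D>)
  then show ?case by blast
qed

text \<open>As in the Bourbaki-Witt theorem, induction on \<open>C\<close> shows that no step jumps
  past any member.\<close>

lemma tower_comparable:
  assumes dec: "\<And>D. s D \<subseteq> D" and C: "C \<in> tower s A" and D: "D \<in> tower s A"
  shows "D \<subseteq> s C \<or> C \<subseteq> D"
proof -
  have "\<forall>D\<in>tower s A. C \<subset> D \<longrightarrow> C \<subseteq> s D"
    using C
  proof induction
    case base
    then show ?case using tower_subset[of s, OF dec] by blast
  next
    case (step C)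
    then have cmp: "E \<subseteq> s C \<or> C \<subseteq> E" if "E \<in> tower s A" for E
      by (intro tower_comparable_aux[of s, OF dec _ that step(1)]) simp
    show ?case
    proof (intro ballI impI)
      fix D assume D: "D \<in> tower s A" "s C \<subset> D"
      then have "C \<subseteq> D" using cmp by blast
      with step.IH D(1) dec[of C] show "s C \<subseteq> s D" by (cases "C = D") auto
    qed
  next
    case (Inter \<C>)
    show ?case
    proof (intro ballI impI)
      fix D assume D: "D \<in> tower s A" "\<Inter>\<C> \<subset> D"
      then obtain C where C: "C \<in> \<C>" "\<not> D \<subseteq> C" by blast
      note IH = Inter.IH[OF C(1)]
      have "D \<subseteq> s C \<or> C \<subseteq> D"
        by (rule tower_comparable_aux[of s, OF dec _ D(1) Inter.hyps(2)[OF C(1)]]) (use IH in blast)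
      then have "C \<subset> D" using C(2) dec[of C] by blast
      then have "C \<subseteq> s D" using IH D(1) by blast
      with C(1) show "\<Inter>\<C> \<subseteq> s D" by blast
    qed
  qed
  then show ?thesis by (intro tower_comparable_aux[of s, OF dec _ D C]) simp
qed

text \<open>This is well-foundedness of the ordinal index. Let \<open>B\<close> be the least member
  above all \<open>C n\<close>. If no \<open>C n\<close> equals \<open>B\<close>, all lie in
  \<open>s B\<close>, so \<open>s B = B\<close> by leastness; then the tower ends at
  \<open>B\<close>, which forces \<open>C 0 = B\<close>.\<close>

lemma tower_incseq_stabilises:
  assumes dec: "\<And>D. s D \<subseteq> D" and C: "\<And>n. C n \<in> tower s A" and "incseq C"
  shows "\<exists>N. \<forall>n\<ge>N. C n = C N"
proof -
  define B where "B = \<Inter>{D \<in> tower s A. \<forall>n. C n \<subseteq> D}"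
  have "A \<in> {D \<in> tower s A. \<forall>n. C n \<subseteq> D}"
    using tower_subset[of s, OF dec C] by (simp add: tower.base)
  then have B: "B \<in> tower s A" unfolding B_def
    by (intro tower.Inter) (blast, simp)
  have CB: "C n \<subseteq> B" for n by (auto simp: B_def)
  have "\<exists>N. C N = B"
  proof (rule ccontr)
    assume ne: "\<nexists>N. C N = B"
    then have "C n \<subseteq> s B" for n
      using tower_comparable[of s, OF dec B C[of n]] CB[of n] by blast
    then have fixB: "s B = B"
      using tower.step[OF B] dec[of B] by (simp add: B_def set_eq_subset Inter_lower)
    have "B \<subseteq> D" if "D \<in> tower s A" for D
      using that
    proof induction
      case base
      then show ?case using tower_subset[of s, OF dec B] .
    next
      case (step D)
      then have "B \<subseteq> s D \<or> D = B" using tower_comparable[of s, OF dec step(1) B] by blast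
      with fixB show ?case by auto
    next
      case (Inter \<D>)
      then show ?case by (intro Inter_greatest)
    qed
    from this[OF C[of 0]] CB[of 0] have "C 0 = B" by simp
    with ne show False by blast
  qed
  then obtain N where N: "C N = B" ..
  have "C n = C N" if "n \<ge> N" for n
    unfolding N using incseqD[OF \<open>incseq C\<close> that] N by (intro subset_antisym[OF CB]) metis
  then show ?thesis by blast
qed

text \<open>The last iterate that still contains \<open>x\<close>, standing for the ordinal at which
  \<open>x\<close> is removed.\<close>

definition tower_at :: "('a set \<Rightarrow> 'a set) \<Rightarrow> 'a set \<Rightarrow> 'a \<Rightarrow> 'a set" where
  "tower_at s A x = \<Inter>{D \<in> tower s A. x \<in> D}"

lemma tower_at:
  assumes "x \<in> A"
  shows "tower_at s A x \<in> tower s A" and "x \<in> tower_at s A x"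
proof -
  show "tower_at s A x \<in> tower s A"
    unfolding tower_at_def by (rule tower.Inter) (use assms tower.base in auto)
qed (simp add: tower_at_def)

lemma tower_at_removed:
  assumes "x \<in> A" and "s (tower_at s A x) \<subset> tower_at s A x"
  shows "x \<notin> s (tower_at s A x)"
  using assms tower.step[OF tower_at(1)[OF assms(1), of s]] by (auto simp: tower_at_def)

text \<open>In terms of ordinals, \<open>y\<close> is removed no later than
  \<open>x\<close>.\<close>

lemma tower_at_mono:
  assumes dec: "\<And>D. s D \<subseteq> D" and "x \<in> A" "y \<in> A" and "y \<notin> s (tower_at s A x)"
  shows "tower_at s A x \<subseteq> tower_at s A y"
  using tower_comparable[of s, OF dec tower_at(1)[OF assms(2), of s] tower_at(1)[OF assms(3), of s]]
    tower_at(2)[OF assms(3), of s] assms(4) by blast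

section \<open>Refining a slice\<close>

text \<open>A stage describes a block \<open>body - rest\<close> of a partition, together with an open set of
  functionals containing the final value of the map \<open>t\<close> on this block.\<close>

datatype ('a, 'b) stage = Stage (body: "'a set") (rest: "'a set") (functionals: "'b set")

definition block :: "('a, 'b) stage \<Rightarrow> 'a set" where
  "block s = body s - rest s"

text \<open>The last clause lets the exhaustion of \<open>body s\<close> continue until it is inside
  \<open>rest s\<close>: a closed convex piece still meeting the block has a slice, by an admissible
  functional, that avoids the rest.\<close>

definition refinable ::
  "('a::real_normed_vector \<Rightarrow>\<^sub>L real) \<Rightarrow> real \<Rightarrow> real \<Rightarrow> ('a, 'a \<Rightarrow>\<^sub>L real) stage \<Rightarrow> bool" where
  "refinable f e M s \<longleftrightarrow> closed (body s) \<and> convex (body s) \<and> body s \<subseteq> cone_set f e M \<and>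
    open (functionals s) \<and> functionals s \<noteq> {} \<and> functionals s \<subseteq> ball f e \<and>
    (\<forall>D. closed D \<longrightarrow> convex D \<longrightarrow> D \<subseteq> body s \<longrightarrow> \<not> D \<subseteq> rest s \<longrightarrow>
      (\<exists>g\<in>functionals s. \<exists>c. (\<exists>x\<in>D. blinfun_apply g x < c) \<and>
        (\<forall>y\<in>rest s \<inter> cone_set f e M. c \<le> g y)))"

text \<open>Closures appear because the final functional is only a limit of admissible ones. The
  last clause protects the rest of the coarser stage \<open>s\<close>, not that of
  \<open>s'\<close>.\<close>

definition refines ::
  "('a::real_normed_vector \<Rightarrow>\<^sub>L real) \<Rightarrow> real \<Rightarrow> real \<Rightarrow> real \<Rightarrow> ('a, 'a \<Rightarrow>\<^sub>L real) stage \<Rightarrow> ('a, 'a \<Rightarrow>\<^sub>L real) stage \<Rightarrow> bool" where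
  "refines f e M \<eta> s s' \<longleftrightarrow> refinable f e M s' \<and>
    (\<forall>y\<in>block s'. \<forall>z\<in>block s'. dist y z < \<eta>) \<and>
    closure (functionals s') \<subseteq> functionals s \<and>
    (\<forall>\<phi>\<in>functionals s'. \<forall>\<psi>\<in>functionals s'. dist \<phi> \<psi> < 2 * \<eta>) \<and>
    (\<forall>\<phi>\<in>closure (functionals s'). \<forall>x\<in>block s'. \<forall>y\<in>cone_set f e M.
      blinfun_apply \<phi> y \<le> \<phi> x \<longrightarrow> y \<notin> rest s)"

text \<open>The stabilisation claim mentions no functional, so that it can later be used with moves
  controlled by the limit functional.\<close>

lemma refinement_exists:
  fixes f :: "'a::banach \<Rightarrow>\<^sub>L real"
  assumes rnp: "radon_nikodym_property TYPE('a)" and s: "refinable f e M s" and "0 < \<eta>"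
  shows "\<exists>N. (\<forall>x\<in>block s. refines f e M \<eta> s (N x) \<and> x \<in> block (N x)) \<and>
    (\<forall>z::nat \<Rightarrow> 'a. (\<forall>n. z n \<in> block s) \<longrightarrow> (\<forall>n. z (Suc n) \<notin> rest (N (z n))) \<longrightarrow>
      (\<exists>n0. \<forall>n\<ge>n0. N (z n) = N (z n0)))"
proof -
  define P where "P D \<longleftrightarrow> closed D \<and> convex D \<and> D \<subseteq> body s" for D
  define Q where "Q D h c \<rho> \<longleftrightarrow> 0 < \<rho> \<and> \<rho> \<le> \<eta> \<and> cball h \<rho> \<subseteq> functionals s \<and>
    (\<exists>x\<in>D. blinfun_apply h x < c) \<and>
    (\<forall>x\<in>D. \<forall>y\<in>D. h x < c \<longrightarrow> h y < c \<longrightarrow> dist x y < \<eta>) \<and>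
    (\<forall>\<phi>\<in>cball h \<rho>. \<forall>x\<in>D. \<forall>y\<in>cone_set f e M.
      h x < c \<longrightarrow> blinfun_apply \<phi> y \<le> \<phi> x \<longrightarrow> y \<notin> rest s)" for D h c \<rho>
  have "\<exists>h c \<rho>. Q D h c \<rho>" if D: "P D" "\<not> D \<subseteq> rest s" for D
  proof -
    have "\<exists>g\<in>functionals s. \<exists>c. (\<exists>x\<in>D. blinfun_apply g x < c) \<and>
        (\<forall>y\<in>rest s \<inter> cone_set f e M. c \<le> g y)"
      using s D unfolding refinable_def P_def by simp
    then obtain g c x0 where g: "g \<in> functionals s" "x0 \<in> D" "blinfun_apply g x0 < c"
      and rest: "\<And>y. y \<in> rest s \<Longrightarrow> y \<in> cone_set f e M \<Longrightarrow> c \<le> g y"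
      by auto
    have D': "closed D" "convex D" "D \<subseteq> cone_set f e M" "open (functionals s)"
      "functionals s \<subseteq> ball f e"
      using s D(1) unfolding refinable_def P_def by auto
    obtain h :: "'a \<Rightarrow>\<^sub>L real" and c' \<rho> where "0 < \<rho>" "\<rho> \<le> \<eta>" "cball h \<rho> \<subseteq> functionals s"
      "\<exists>x\<in>D. h x < c'"
      "\<And>x y. x \<in> D \<Longrightarrow> y \<in> D \<Longrightarrow> h x < c' \<Longrightarrow> h y < c' \<Longrightarrow> dist x y < \<eta>"
      "\<And>\<phi> x y. \<phi> \<in> cball h \<rho> \<Longrightarrow> x \<in> D \<Longrightarrow> h x < c' \<Longrightarrow> y \<in> cone_set f e M \<Longrightarrow>
        blinfun_apply \<phi> y \<le> \<phi> x \<Longrightarrow> g y < c"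
      using small_slice_room[OF rnp D' g \<open>0 < \<eta>\<close>] by metis
    then have "Q D h c' \<rho>" unfolding Q_def using rest by (meson not_less)
    then show ?thesis by blast
  qed
  then obtain h c \<rho> where Q: "\<And>D. P D \<Longrightarrow> \<not> D \<subseteq> rest s \<Longrightarrow> Q D (h D) (c D) (\<rho> D)"
    by metis
  \<comment> \<open>Leaving all other sets unchanged makes \<open>cut\<close> decreasing on every
    set, as towers require.\<close>
  define cut where
    "cut D = (if P D \<and> \<not> D \<subseteq> rest s then D \<inter> {x. c D \<le> blinfun_apply (h D) x} else D)" for D
  define A where "A = body s"
  have dec: "cut D \<subseteq> D" for D by (simp add: cut_def)
  have half_space: "closed {x. a \<le> blinfun_apply g x}" "convex {x. a \<le> blinfun_apply g x}"
    for a and g :: "'a \<Rightarrow>\<^sub>L real"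
    by (rule closed_half_space_blinfun convex_half_space_blinfun)+
  have P_tower: "P D" if "D \<in> tower cut A" for D
    using that
  proof induction
    case base
    then show ?case using s by (simp add: P_def A_def refinable_def)
  next
    case (step D)
    then show ?case by (auto simp: P_def cut_def intro!: closed_Int convex_Int half_space)
  next
    case (Inter \<D>)
    then show ?case by (auto simp: P_def intro: convex_Inter)
  qed
  define T where "T = tower_at cut A"
  \<comment> \<open>The rest is the whole half space, so \<open>h (T x)\<close> itself witnesses the
    last clause of \<open>refinable\<close>. \<open>N\<close> depends on \<open>x\<close> only
    through \<open>T x\<close>, hence stabilises with it.\<close>
  define N where "N x = Stage (T x) {y. c (T x) \<le> blinfun_apply (h (T x)) y} (ball (h (T x)) (\<rho> (T x)))" for x
  have T: "T x \<in> tower cut A" "P (T x)" "Q (T x) (h (T x)) (c (T x)) (\<rho> (T x))"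
      "cut (T x) = T x \<inter> rest (N x)" "x \<in> block (N x)" if x: "x \<in> block s" for x
  proof -
    have xA: "x \<in> A" and xs: "x \<notin> rest s" using x by (simp_all add: block_def A_def)
    show tow: "T x \<in> tower cut A" and PT: "P (T x)"
      using tower_at(1)[OF xA] P_tower by (auto simp: T_def)
    have xT: "x \<in> T x" using tower_at(2)[OF xA] by (simp add: T_def)
    with xs have ns: "\<not> T x \<subseteq> rest s" by blast
    show QT: "Q (T x) (h (T x)) (c (T x)) (\<rho> (T x))" by (rule Q[OF PT ns])
    show cutT: "cut (T x) = T x \<inter> rest (N x)" using PT ns by (simp add: cut_def N_def)
    have "cut (T x) \<subset> T x" unfolding cutT using QT by (force simp: N_def Q_def)
    then have "x \<notin> cut (T x)" using tower_at_removed[of x A cut] xA by (simp add: T_def)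
    with xT show "x \<in> block (N x)" unfolding cutT by (simp add: block_def N_def)
  qed
  have "refines f e M \<eta> s (N x)" if x: "x \<in> block s" for x
  proof -
    note Tx = T[OF x, unfolded Q_def P_def]
    have cl: "closure (functionals (N x)) \<subseteq> cball (h (T x)) (\<rho> (T x))"
      unfolding N_def stage.sel by (rule closure_minimal[OF ball_subset_cball closed_cball])
    have blk: "block (N x) = {y \<in> T x. blinfun_apply (h (T x)) y < c (T x)}"
      by (auto simp: block_def N_def)
    have "functionals (N x) \<subseteq> functionals s"
      using cl closure_subset Tx(3) by blast
    then have "functionals (N x) \<subseteq> ball f e" using s unfolding refinable_def by blast
    moreover have "T x \<subseteq> cone_set f e M" using Tx(2) s unfolding refinable_def by blast
    moreover have "\<exists>g\<in>functionals (N x). \<exists>b. (\<exists>y\<in>D. blinfun_apply g y < b) \<and>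
        (\<forall>y\<in>rest (N x) \<inter> cone_set f e M. b \<le> g y)"
      if "\<not> D \<subseteq> rest (N x)" for D
      using that Tx(3)
      by (intro bexI[of _ "h (T x)"] exI[of _ "c (T x)"]) (auto simp: N_def not_le)
    ultimately have "refinable f e M (N x)"
      using Tx(2,3) unfolding refinable_def by (auto simp: N_def)
    moreover have "dist \<phi> \<psi> < 2 * \<eta>" if "\<phi> \<in> functionals (N x)" "\<psi> \<in> functionals (N x)" for \<phi> \<psi>
      using that Tx(3) dist_triangle3[of \<phi> \<psi> "h (T x)"] by (simp add: N_def)
    ultimately show ?thesis
      unfolding refines_def blk using cl Tx(3) by blast
  qed
  moreover have "\<exists>n0. \<forall>n\<ge>n0. N (z n) = N (z n0)"
    if z: "\<And>n. z n \<in> block s" "\<And>n. z (Suc n) \<notin> rest (N (z n))" for z :: "nat \<Rightarrow> 'a"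
  proof -
    have zA: "z n \<in> A" for n using z(1)[of n] by (simp add: block_def A_def)
    have "incseq (\<lambda>n. T (z n))"
    proof (rule incseq_SucI)
      fix n
      have "z (Suc n) \<notin> cut (T (z n))" using z(2)[of n] T(4)[OF z(1)] by simp
      then show "T (z n) \<le> T (z (Suc n))"
        unfolding T_def by (rule tower_at_mono[of cut, OF dec zA zA])
    qed
    then obtain n0 where "\<forall>n\<ge>n0. T (z n) = T (z n0)"
      using tower_incseq_stabilises[of cut "\<lambda>n. T (z n)", OF dec T(1)[OF z(1)]] by blast
    then have "\<forall>n\<ge>n0. N (z n) = N (z n0)" by (metis N_def)
    then show ?thesis ..
  qed
  ultimately show ?thesis using T(5) by blast
qed

section \<open>The limit map\<close>

text \<open>A point \<open>x\<close> outside the smaller cone set is cut off by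
  \<open>f - r *\<^sub>R u\<close> with \<open>u\<close> norming \<open>x\<close>: for
  \<open>r = e\<close> the value at \<open>x\<close> would be \<open>f x - e * norm x < - K\<close>,
  while on the smaller set \<open>r * u y \<le> e * norm y\<close> keeps the value at least
  \<open>- K\<close>.\<close>

lemma refinable_cone_sets:
  fixes f :: "'a::real_normed_vector \<Rightarrow>\<^sub>L real"
  assumes e: "0 < e" and "K \<le> M"
  shows "refinable f e M (Stage (cone_set f e M) (cone_set f e K) (ball f e))"
proof -
  have "\<exists>g\<in>ball f e. \<exists>c. (\<exists>x\<in>D. blinfun_apply g x < c) \<and>
      (\<forall>y\<in>cone_set f e K \<inter> cone_set f e M. c \<le> g y)"
    if D: "\<not> D \<subseteq> cone_set f e K" for D :: "'a set"
  proof -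
    obtain x where x: "x \<in> D" "f x - e * norm x < - K"
      using D by (force simp: cone_set_def)
    obtain u :: "'a \<Rightarrow>\<^sub>L real" where u: "norm u \<le> 1" "u x = norm x"
      using norming_functional[of x] by blast
    define \<gamma> where "\<gamma> = - K - (f x - e * norm x)"
    \<comment> \<open>\<open>r < e\<close> puts the functional into the open ball; the summand
      \<open>1\<close> makes \<open>(e - r) * norm x\<close> strictly smaller than
      \<open>\<gamma>\<close>.\<close>
    define r where "r = e - min e (\<gamma> / (norm x + 1))"
    have "0 < \<gamma>" using x(2) by (simp add: \<gamma>_def)
    moreover have "0 < norm x + 1" using norm_ge_zero[of x] by linarith
    ultimately have q: "0 < \<gamma> / (norm x + 1)" by simp
    have r: "0 \<le> r" "r < e" using e q by (auto simp: r_def)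
    have "e - r \<le> \<gamma> / (norm x + 1)" by (simp add: r_def)
    then have "(e - r) * (norm x + 1) \<le> \<gamma>" using \<open>0 < norm x + 1\<close> by (simp add: pos_le_divide_eq)
    with r(2) have "(e - r) * norm x < \<gamma>" by (simp add: distrib_left)
    then have "(f - r *\<^sub>R u) x < - K"
      by (simp add: \<gamma>_def blinfun.diff_left blinfun.scaleR_left u(2) algebra_simps)
    moreover have "- K \<le> (f - r *\<^sub>R u) y" if "y \<in> cone_set f e K" for y
    proof -
      have "u y \<le> norm y"
        using norm_blinfun[of u y] u(1) mult_right_mono[of "norm u" 1 "norm y"] by simp
      then have "r * u y \<le> e * norm y" using r by (intro order_trans[OF mult_left_mono mult_right_mono]) auto
      with that show ?thesis by (simp add: cone_set_def blinfun.diff_left blinfun.scaleR_left)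
    qed
    moreover have "norm (r *\<^sub>R u) \<le> r * 1" using r u(1) by (simp add: mult_left_le)
    then have "f - r *\<^sub>R u \<in> ball f e" using r(2) by (simp add: dist_norm)
    ultimately show ?thesis using x(1) by blast
  qed
  with e show ?thesis
    by (simp add: refinable_def closed_cone_set convex_cone_set)
qed

lemma bounded_above_int_incseq_stabilises:
  fixes l :: "nat \<Rightarrow> int"
  assumes "\<And>n. l n \<le> l (Suc n)" and "\<And>n. l n \<le> B"
  shows "\<exists>N. \<forall>n\<ge>N. l n = l N"
proof -
  have inc: "l m \<le> l n" if "m \<le> n" for m n using lift_Suc_mono_le[of l, OF assms(1) that] .
  then have "range l \<subseteq> {l 0..B}" using assms(2) by auto
  then have fin: "finite (range l)" using finite_subset by blast
  then have "Max (range l) \<in> range l" by (intro Max_in) auto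
  then obtain N where N: "Max (range l) = l N" by blast
  have "l n = l N" if "n \<ge> N" for n
    using inc[OF that] Max_ge[OF fin, of "l n"] N by simp
  then show ?thesis by blast
qed

text \<open>On \<open>cone_set f e i\<close> functionals in \<open>ball f e\<close> have bounded slices. A sequence with
  \<open>f (x n) - \<epsilon> * norm (x n)\<close> bounded below has bounded levels, and the levels never decrease because
  the functional chosen at \<open>x\<close> keeps the next point out of the lower cone set. Dividing \<open>\<epsilon>\<close> by three
  leaves room for normalising the limit functional \<open>G x\<close>.\<close>

theorem theorem1p2:
  fixes f :: "'a::banach \<Rightarrow>\<^sub>L real" and \<epsilon> :: real
  assumes "radon_nikodym_property TYPE('a)"
    and "f \<in> sphere 0 1"
    and "0 < \<epsilon>" and "\<epsilon> < 1"
  shows "\<exists>t :: 'a \<Rightarrow> ('a \<Rightarrow>\<^sub>L real).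
    (\<forall>x. t x \<in> sphere 0 1 \<inter> ball f \<epsilon>) \<and>
    (\<forall>x :: nat \<Rightarrow> 'a.
      bdd_below (range (\<lambda>n. blinfun_apply f (x n) - \<epsilon> * norm (x n))) \<longrightarrow>
      (\<forall>n. blinfun_apply (t (x n)) (x (Suc n) - x n) \<le> 0) \<longrightarrow>
      convergent x)"
proof -
  define e where "e = \<epsilon> / 3"
  have e: "0 < e" "3 * e = \<epsilon>" "e < 1" using assms(3,4) by (simp_all add: e_def)
  define lev where "lev x = \<lceil>e * norm x - f x\<rceil>" for x
  have lev_iff: "x \<in> cone_set f e (of_int i) \<longleftrightarrow> lev x \<le> i" for x i
    by (auto simp: lev_def cone_set_def ceiling_le_iff)
  \<comment> \<open>One refinement is chosen for each \<open>M\<close>, \<open>k\<close> and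
    \<open>s\<close>, so points of equal level that share a stage are partitioned by the same
    map.\<close>
  have "\<exists>Nx. \<forall>M k s. refinable f e M s \<longrightarrow>
    (\<forall>x\<in>block s. refines f e M ((1/2)^k) s (Nx M k s x) \<and> x \<in> block (Nx M k s x)) \<and>
    (\<forall>z::nat \<Rightarrow> 'a. (\<forall>n. z n \<in> block s) \<longrightarrow> (\<forall>n. z (Suc n) \<notin> rest (Nx M k s (z n))) \<longrightarrow>
      (\<exists>n0. \<forall>n\<ge>n0. Nx M k s (z n) = Nx M k s (z n0)))"
    (is "\<exists>Nx. \<forall>M k s. refinable f e M s \<longrightarrow> ?R M k s (Nx M k s)")
  proof (intro exI allI impI)
    fix M k s assume "refinable f e M s"
    then have "\<exists>N. ?R M k s N" by (intro refinement_exists[OF assms(1)]) simp_all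
    then show "?R M k s ((\<lambda>M k s. SOME N. ?R M k s N) M k s)" by (rule someI_ex)
  qed
  then obtain Nx where
    Nx: "\<And>M k s x. refinable f e M s \<Longrightarrow> x \<in> block s \<Longrightarrow>
        refines f e M ((1/2)^k) s (Nx M k s x) \<and> x \<in> block (Nx M k s x)" and
    stab: "\<And>M k s z. refinable f e M s \<Longrightarrow> (\<And>n::nat. z n \<in> block s) \<Longrightarrow>
        (\<And>n. z (Suc n) \<notin> rest (Nx M k s (z n))) \<Longrightarrow>
        \<exists>n0. \<forall>n\<ge>n0. Nx M k s (z n) = Nx M k s (z n0)"
    by blast
  define S where "S x = rec_nat
    (Stage (cone_set f e (of_int (lev x))) (cone_set f e (of_int (lev x - 1))) (ball f e))
    (\<lambda>k s. Nx (of_int (lev x)) k s x)" for x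
  have S0: "S x 0 = Stage (cone_set f e (of_int (lev x))) (cone_set f e (of_int (lev x - 1))) (ball f e)"
    and SSuc: "S x (Suc k) = Nx (of_int (lev x)) k (S x k) x" for x k
    by (simp_all add: S_def)
  have S: "refinable f e (of_int (lev x)) (S x k) \<and> x \<in> block (S x k)" for x k
  proof (induction k)
    case 0
    have "refinable f e (of_int (lev x)) (S x 0)" unfolding S0
      by (rule refinable_cone_sets[OF e(1)]) simp
    moreover have "x \<in> block (S x 0)" unfolding block_def S0 stage.sel Diff_iff lev_iff by simp
    ultimately show ?case by blast
  next
    case (Suc k)
    with Nx[of _ "S x k" x k] show ?case by (simp add: SSuc refines_def)
  qed
  then have ref: "refines f e (of_int (lev x)) ((1/2)^k) (S x k) (S x (Suc k))" for x k
    using Nx[of _ "S x k" x k] by (simp add: SSuc)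
  have nest: "closure (functionals (S x (Suc k))) \<subseteq> functionals (S x k)" for x k
    using ref[of x k] by (simp add: refines_def)
  have "\<exists>G. \<forall>k. G \<in> closure (functionals (S x k))" for x
  proof -
    let ?F = "\<lambda>k. closure (functionals (S x k))"
    obtain G where "\<And>k. G \<in> ?F k"
    proof (rule decreasing_closed_nest[of ?F])
      show "?F k \<noteq> {}" for k using S[of x k] by (simp add: refinable_def)
      have "?F (Suc k) \<subseteq> ?F k" for k using order_trans[OF nest closure_subset] .
      then show "?F n \<subseteq> ?F m" if "m \<le> n" for m n
        using lift_Suc_antimono_le[of ?F] that by blast
      fix d :: real assume "d > 0"
      then obtain k where k: "(1/2::real) ^ k < d / 2"
        using real_arch_pow_inv[of "d / 2" "1/2"] by auto
      \<comment> \<open>Two steps are needed: stage \<open>k + 1\<close> has small diameter, and it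
        contains the closure of stage \<open>k + 2\<close>.\<close>
      have "dist \<phi> \<psi> < 2 * (1/2) ^ k" if "\<phi> \<in> functionals (S x (Suc k))" "\<psi> \<in> functionals (S x (Suc k))" for \<phi> \<psi>
        using ref[of x k] that by (simp add: refines_def)
      with k nest[of x "Suc k"] show "\<exists>n. \<forall>\<phi>\<in>?F n. \<forall>\<psi>\<in>?F n. dist \<phi> \<psi> < d"
        by (intro exI[of _ "Suc (Suc k)"]) fastforce
    qed auto
    then show ?thesis by blast
  qed
  then obtain G where G: "\<And>x k. G x \<in> closure (functionals (S x k))" by metis
  \<comment> \<open>Stage \<open>k + 1\<close> protects the rest of stage \<open>k\<close>; the
    shift is harmless since \<open>G x\<close> lies in the closures of all stages.\<close>
  have no_rest: "y \<notin> rest (S x k)" if "lev y \<le> lev x" "G x y \<le> G x x" for x y k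
  proof -
    have "y \<in> cone_set f e (of_int (lev x))" using that(1) by (simp add: lev_iff)
    with that(2) G[of x "Suc k"] S[of x "Suc k"] ref[of x k] show ?thesis
      unfolding refines_def by blast
  qed
  define t where "t x = (1 / norm (G x)) *\<^sub>R G x" for x
  have Gf: "norm (G x - f) < e" for x
    using subsetD[OF nest[of x 0] G[of x "Suc 0"]] by (simp add: S0 dist_norm norm_minus_commute)
  have f1: "norm f = 1" using assms(2) by simp
  have G0: "0 < norm (G x)" for x
    using Gf[of x] norm_triangle_ineq2[of f "G x"] norm_minus_commute[of f "G x"] f1 e(3)
    by linarith
  have "t x \<in> sphere 0 1 \<inter> ball f \<epsilon>" for x
  proof -
    have "t x - G x = (1 / norm (G x) - 1) *\<^sub>R G x" by (simp add: t_def scaleR_left_diff_distrib)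
    then have "norm (t x - G x) = \<bar>(1 / norm (G x) - 1) * norm (G x)\<bar>" by (simp add: abs_mult)
    also have "\<dots> = \<bar>norm f - norm (G x)\<bar>" using G0[of x] f1 by (simp add: left_diff_distrib)
    also have "\<dots> \<le> norm (G x - f)" using norm_triangle_ineq3[of f "G x"] by (simp add: norm_minus_commute)
    finally have "norm (t x - f) < \<epsilon>"
      using norm_triangle_ineq[of "t x - G x" "G x - f"] Gf[of x] e by simp
    moreover have "norm (t x) = 1" using G0[of x] by (simp add: t_def)
    ultimately show ?thesis by (simp add: dist_norm norm_minus_commute)
  qed
  moreover have "convergent x"
    if bdd: "bdd_below (range (\<lambda>n. blinfun_apply f (x n) - \<epsilon> * norm (x n)))"
      and desc: "\<And>n. blinfun_apply (t (x n)) (x (Suc n) - x n) \<le> 0" for x :: "nat \<Rightarrow> 'a"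
  proof -
    have step: "G (x n) (x (Suc n)) \<le> G (x n) (x n)" for n
    proof -
      have "1 / norm (G (x n)) * G (x n) (x (Suc n) - x n) \<le> 1 / norm (G (x n)) * 0"
        using desc[of n] by (simp add: t_def blinfun.scaleR_left)
      then have "G (x n) (x (Suc n) - x n) \<le> 0"
        using G0[of "x n"] by (subst (asm) mult_le_cancel_left_pos) simp_all
      then show ?thesis by (simp add: blinfun.diff_right)
    qed
    \<comment> \<open>The rest of stage \<open>0\<close> is the next lower cone set, so a drop in
      level would be a move into it.\<close>
    have mono: "lev (x n) \<le> lev (x (Suc n))" for n
    proof (rule ccontr)
      assume "\<not> ?thesis"
      then have less: "lev (x (Suc n)) < lev (x n)" by simp
      then have "x (Suc n) \<in> rest (S (x n) 0)" unfolding S0 stage.sel lev_iff by simp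
      with no_rest[OF _ step] less show False by simp
    qed
    obtain L where L: "\<And>n. L \<le> f (x n) - \<epsilon> * norm (x n)" using bdd by (auto simp: bdd_below_def)
    have "lev (x n) \<le> \<lceil>- L\<rceil>" for n
    proof -
      have "e * norm (x n) \<le> \<epsilon> * norm (x n)" using e by (intro mult_right_mono) auto
      with L[of n] show ?thesis unfolding lev_def by (intro ceiling_mono) simp
    qed
    then obtain N0 where N0: "\<And>n. n \<ge> N0 \<Longrightarrow> lev (x n) = lev (x N0)"
      using bounded_above_int_incseq_stabilises[of "\<lambda>n. lev (x n)"] mono by blast
    \<comment> \<open>Once stage \<open>k\<close> is constant, the tail moves inside one block and
      \<open>no_rest\<close> keeps it out of the next rest, so the refinement stabilises. The bound
      \<open>N \<ge> N0\<close> keeps the level, and with it the parameter \<open>M\<close>,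
      constant too.\<close>
    have ev: "\<exists>N\<ge>N0. \<forall>n\<ge>N. S (x n) k = S (x N) k" for k
    proof (induction k)
      case 0
      have "S (x n) 0 = S (x N0) 0" if "n \<ge> N0" for n unfolding S0 N0[OF that] ..
      then show ?case by blast
    next
      case (Suc k)
      then obtain N where N: "N \<ge> N0" "\<And>n. n \<ge> N \<Longrightarrow> S (x n) k = S (x N) k" by blast
      let ?s = "S (x N) k" and ?M = "of_int (lev (x N0)) :: real"
      have eq: "S (x n) (Suc k) = Nx ?M k ?s (x n)" if "n \<ge> N" for n
        using N(2)[OF that] N0[of n] N(1) that by (simp add: SSuc)
      define z where "z n = x (N + n)" for n
      have zS: "S (z n) (Suc k) = Nx ?M k ?s (z n)" "S (z n) k = ?s" for n
        using eq[of "N + n"] N(2)[of "N + n"] by (simp_all add: z_def)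
      have "\<exists>n0. \<forall>n\<ge>n0. Nx ?M k ?s (z n) = Nx ?M k ?s (z n0)"
      proof (rule stab)
        show "refinable f e ?M ?s" using S[of "x N" k] N0[OF N(1)] by simp
        show "z n \<in> block ?s" for n using S[of "z n" k] zS(2)[of n] by simp
        have "lev (z (Suc n)) \<le> lev (z n)" "G (z n) (z (Suc n)) \<le> G (z n) (z n)" for n
          using N0[of "N + n"] N0[of "Suc (N + n)"] N(1) step[of "N + n"] by (simp_all add: z_def)
        then show "z (Suc n) \<notin> rest (Nx ?M k ?s (z n))" for n
          using no_rest[of "z (Suc n)" "z n" "Suc k"] by (simp add: zS(1))
      qed
      then obtain n0 where "\<And>n. n \<ge> n0 \<Longrightarrow> S (z n) (Suc k) = S (z n0) (Suc k)"
        unfolding zS(1)[symmetric] by blast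
      then have "S (x n) (Suc k) = S (x (N + n0)) (Suc k)" if "n \<ge> N + n0" for n
        using that unfolding z_def by (metis add_leD1 le_add_diff_inverse nat_add_left_cancel_le)
      moreover have "N + n0 \<ge> N0" using N(1) by simp
      ultimately show ?case by blast
    qed
    have "Cauchy x"
    proof (rule metric_CauchyI)
      fix d :: real assume "d > 0"
      then obtain k where k: "(1/2::real) ^ k < d" using real_arch_pow_inv[of d "1/2"] by auto
      obtain N where N: "\<And>n. n \<ge> N \<Longrightarrow> S (x n) (Suc k) = S (x N) (Suc k)" using ev by blast
      have "x n \<in> block (S (x N) (Suc k))" if "n \<ge> N" for n
        using S[of "x n" "Suc k"] N[OF that] by simp
      then have "dist (x m) (x n) < (1/2)^k" if "m \<ge> N" "n \<ge> N" for m n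
        using ref[of "x N" k] that by (simp add: refines_def)
      with k show "\<exists>N. \<forall>m\<ge>N. \<forall>n\<ge>N. dist (x m) (x n) < d" by (meson less_trans)
    qed
    then show ?thesis by (rule Cauchy_convergent)
  qed
  ultimately show ?thesis by blast
qed

end
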